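(* Let $D$ be an integral domain with quotient field $K$, and let $T$ be an overring of $D$ (a ring with $D\subseteq T\subseteq K$) that is a principal ideal domain. Let $I:=(D:T)=\{x\in K\mid xT\subseteq D\}$. If $I\neq(0)$, then the partially ordered sets $\mathrm{FStar}(D)$, $\mathrm{Mult}_0(D,T)$ and $\mathrm{Mult}_0(D/I,T/I)$ are order-isomorphic.
   Context: All rings are commutative with unit. For a ring extension $A\subseteq B$, $\mathbf{F}_A(B)$ is the set of $A$-submodules of $B$, ordered by inclusion; for $I\in\mathbf{F}_A(B)$ and $b\in B$, $(I:b):=\{x\in B\mid bx\in I\}$. A closure operation on a partially ordered set is an extensive, order-preserving, idempotent self-map. For $\mathcal{G}\subseteq\mathbf{F}_A(B)$, a multiplicative operation on $(A,B,\mathcal{G})$ is a closure operation $\star:\mathcal{G}\to\mathcal{G}$, $I\mapsto I^\star$, such that $(I:b)^\star\subseteq(I^\star:b)$ for all $I\in\mathcal{G}$, $b\in B$ with $(I:b)\in\mathcal{G}$. $\mathrm{Mult}(A,B,\mathcal{G})$ is the set of these, ordered by $\star_1\leq\star_2$ iff $I^{\star_1}\subseteq I^{\star_2}$ for all $I\in\mathcal{G}$. Set $\mathcal{F}_0(A,B):=\{I\in\mathbf{F}_A(B)\mid IB=B\}$ and $\mathrm{Mult}_0(A,B):=\mathrm{Mult}(A,B,\mathcal{F}_0(A,B))$. A fractional ideal of $D$ is a $D$-submodule $I$ of $K$ with $dI\subseteq D$ for some $d\in D\setminus\{0\}$; $\mathcal{F}(D)$ is the set of all of them. A fractional star operation on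 $D$ is a closure operation $\star$ on $(\mathcal{F}(D),\subseteq)$ with $x\cdot I^\star=(xI)^\star$ for all $x\in K$, $I\in\mathcal{F}(D)$. $\mathrm{FStar}(D)$ is the set of fractional star operations, ordered pointwise by inclusion. (Equivalently, these are the multiplicative operations on $(D,K,\mathcal{F}(D)\setminus\{(0)\})$.) *)

theory Defs
  imports "HOL-Algebra.Algebra"
begin

definition order_isomorphic :: "('a, 'c) gorder_scheme \<Rightarrow> ('b, 'd) gorder_scheme \<Rightarrow> bool"
  where "order_isomorphic L M \<longleftrightarrow> (\<exists>f. order_emb L M f \<and> bij_betw f (carrier L) (carrier M))"

definition inclusion_order :: "'a set set \<Rightarrow> 'a set gorder"
  where "inclusion_order G = \<lparr>carrier = G, eq = (=), le = (\<subseteq>)\<rparr>"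

definition pointwise_order :: "'a set set \<Rightarrow> ('a set \<Rightarrow> 'a set) set \<Rightarrow> ('a set \<Rightarrow> 'a set) gorder"
  where "pointwise_order G S =
    \<lparr>carrier = S, eq = (=), le = (\<lambda>s t. \<forall>I\<in>G. s I \<subseteq> t I)\<rparr>"

text \<open>Maps are taken to be extensional (\<open>undefined\<close> outside the carrier), so that two
  closure operations are equal in HOL iff they agree on the poset.\<close>

definition closure_operation :: "('a, 'b) gorder_scheme \<Rightarrow> ('a \<Rightarrow> 'a) \<Rightarrow> bool"
  where "closure_operation L s \<longleftrightarrow>
    s \<in> carrier L \<rightarrow>\<^sub>E carrier L \<and> (\<forall>x\<in>carrier L. x \<sqsubseteq>\<^bsub>L\<^esub> s x) \<and> isotone L L s \<and> Idem\<^bsub>L\<^esub> s"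

text \<open>A ring extension \<open>A \<subseteq> B\<close> is given by a ring \<open>B\<close> and a subset \<open>A\<close> of its carrier.
  Despite its name, \<^const>\<open>subalgebra\<close> \<open>A I B\<close> says exactly that \<open>I\<close> is an \<open>A\<close>-submodule of
  \<open>B\<close>: an additive subgroup closed under multiplication by elements of \<open>A\<close>.\<close>

definition submodules :: "'a set \<Rightarrow> ('a, 'b) ring_scheme \<Rightarrow> 'a set set"
  where "submodules A B = {I. subalgebra A I B}"

definition residual :: "('a, 'b) ring_scheme \<Rightarrow> 'a set \<Rightarrow> 'a \<Rightarrow> 'a set"
  where "residual B I b = {x \<in> carrier B. b \<otimes>\<^bsub>B\<^esub> x \<in> I}"

text \<open>The ring \<open>A\<close> of a triple \<open>(A, B, G)\<close> enters only through \<open>G \<subseteq> submodules A B\<close>.\<close>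

definition multiplicative_operations ::
    "('a, 'b) ring_scheme \<Rightarrow> 'a set set \<Rightarrow> ('a set \<Rightarrow> 'a set) set"
  where "multiplicative_operations B G =
    {s. closure_operation (inclusion_order G) s \<and>
        (\<forall>I\<in>G. \<forall>b\<in>carrier B. residual B I b \<in> G \<longrightarrow> s (residual B I b) \<subseteq> residual B (s I) b)}"

definition Mult :: "('a, 'b) ring_scheme \<Rightarrow> 'a set set \<Rightarrow> ('a set \<Rightarrow> 'a set) gorder"
  where "Mult B G = pointwise_order G (multiplicative_operations B G)"

text \<open>\<^const>\<open>ideal_prod\<close> \<open>B I J\<close> is the set of finite nonempty sums of products \<open>i \<otimes> j\<close>, so
  for a submodule \<open>I\<close> it gives the usual product \<open>IB\<close> when \<open>J\<close> is the carrier of \<open>B\<close>.\<close>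

definition F0 :: "'a set \<Rightarrow> ('a, 'b) ring_scheme \<Rightarrow> 'a set set"
  where "F0 A B = {I \<in> submodules A B. I \<cdot>\<^bsub>B\<^esub> (carrier B) = carrier B}"

definition Mult0 :: "'a set \<Rightarrow> ('a, 'b) ring_scheme \<Rightarrow> ('a set \<Rightarrow> 'a set) gorder"
  where "Mult0 A B = Mult B (F0 A B)"

definition quotient_field :: "('a, 'b) ring_scheme \<Rightarrow> 'a set \<Rightarrow> bool"
  where "quotient_field K D \<longleftrightarrow> field K \<and> subdomain D K \<and>
    (\<forall>x\<in>carrier K. \<exists>a\<in>D. \<exists>b\<in>D - {\<zero>\<^bsub>K\<^esub>}. x = a \<otimes>\<^bsub>K\<^esub> inv\<^bsub>K\<^esub> b)"

definition fractional_ideals :: "('a, 'b) ring_scheme \<Rightarrow> 'a set \<Rightarrow> 'a set set"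
  where "fractional_ideals K D =
    {I \<in> submodules D K. \<exists>d\<in>D - {\<zero>\<^bsub>K\<^esub>}. d <#\<^bsub>K\<^esub> I \<subseteq> D}"

definition fractional_star_operations ::
    "('a, 'b) ring_scheme \<Rightarrow> 'a set \<Rightarrow> ('a set \<Rightarrow> 'a set) set"
  where "fractional_star_operations K D =
    {s. closure_operation (inclusion_order (fractional_ideals K D)) s \<and>
        (\<forall>x\<in>carrier K. \<forall>I\<in>fractional_ideals K D. x <#\<^bsub>K\<^esub> (s I) = s (x <#\<^bsub>K\<^esub> I))}"

definition FStar :: "('a, 'b) ring_scheme \<Rightarrow> 'a set \<Rightarrow> ('a set \<Rightarrow> 'a set) gorder"
  where "FStar K D = pointwise_order (fractional_ideals K D) (fractional_star_operations K D)"

definition conductor :: "('a, 'b) ring_scheme \<Rightarrow> 'a set \<Rightarrow> 'a set \<Rightarrow> 'a set"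
  where "conductor K D T = {x \<in> carrier K. \<forall>t\<in>T. x \<otimes>\<^bsub>K\<^esub> t \<in> D}"

text \<open>For subrings \<open>D \<subseteq> T\<close> of \<open>K\<close> and a common ideal \<open>I\<close>, a coset \<open>I + d\<close> with \<open>d \<in> D\<close> is the same
  set in \<open>D/I\<close> and in \<open>T/I\<close>, so the carrier of \<open>D/I\<close> is a subset of the carrier of \<open>T/I\<close>; the
  ring operations agree because all of them are inherited from \<open>K\<close>.\<close>

end

theory Submission
  imports Defs
begin

text \<open>Write \<open>F\<^sub>0\<close> for the \<open>D\<close>-submodules \<open>J\<close> of \<open>T\<close> with \<open>JT = T\<close>. Both comparisons rest on the
  fact that these submodules carry all the information.

  Fractional ideals. If \<open>F\<close> is a nonzero fractional ideal of \<open>D\<close>, then \<open>FT\<close> is a fractional ideal of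
  the principal ideal domain \<open>T\<close>, hence \<open>FT = xT\<close> and \<open>F = xJ\<close> with \<open>J = x\<inverse>F\<close> in \<open>F\<^sub>0\<close>
  (\<open>fractional_ideal_factor\<close>). Conversely, a nonzero \<open>c\<close> in the conductor satisfies \<open>cT \<subseteq> D\<close>, so
  every \<open>xJ\<close> is fractional. A star operation commutes with scaling, so it is determined by its values
  on \<open>F\<^sub>0\<close>; it fixes \<open>T\<close> (\<open>star_fixes_overring\<close>), so it maps \<open>F\<^sub>0\<close> to itself, and its restriction
  is multiplicative because \<open>b(J : b) \<subseteq> J\<close>. In the other direction, a multiplicative operation \<open>s\<close> on
  \<open>F\<^sub>0\<close> extends by \<open>xJ \<mapsto> x s(J)\<close>. That this is well defined and monotone is the heart of the matter
  (\<open>scaled_operation_mono\<close>): an inclusion \<open>xJ \<subseteq> yJ'\<close> forces \<open>x = yb\<close> with \<open>b \<in> T\<close> and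
  \<open>J \<subseteq> (J' : b)\<close>, and then the residual axiom gives \<open>b s(J) \<subseteq> s(J')\<close>.

  Quotients. The conductor \<open>I\<close> lies in every \<open>J\<close> in \<open>F\<^sub>0\<close>: since \<open>IT = I \<subseteq> D\<close>, one has
  \<open>I = IJT = (IT)J \<subseteq> DJ \<subseteq> J\<close>. So the correspondence between submodules of \<open>T/I\<close> and submodules
  of \<open>T\<close> that contain \<open>I\<close> matches the two sets \<open>F\<^sub>0\<close>. It also respects residuals, hence transports
  multiplicative operations (\<open>Mult0_surjective_image\<close>, stated for any surjective homomorphism).\<close>

section \<open>Closure operations and orders on maps\<close>

lemma closure_operation_inclusion_order_iff:
  "closure_operation (inclusion_order G) s \<longleftrightarrow>
    s \<in> G \<rightarrow>\<^sub>E G \<and> (\<forall>I\<in>G. I \<subseteq> s I) \<and> (\<forall>I\<in>G. \<forall>J\<in>G. I \<subseteq> J \<longrightarrow> s I \<subseteq> s J) \<and>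
    (\<forall>I\<in>G. s (s I) = s I)"
proof -
  have "weak_partial_order (inclusion_order G)"
    by unfold_locales (auto simp: inclusion_order_def)
  then show ?thesis
    by (simp add: closure_operation_def isotone_def idempotent_def) (simp add: inclusion_order_def)
qed

text \<open>Antisymmetry is the only point of substance: inclusion both ways on \<open>G\<close> gives equal maps just
  because the maps are extensional.\<close>

lemma weak_partial_order_pointwise_order:
  assumes "S \<subseteq> extensional G"
  shows "weak_partial_order (pointwise_order G S)"
proof
  fix s t
  assume "s \<in> carrier (pointwise_order G S)" "t \<in> carrier (pointwise_order G S)"
    and "s \<sqsubseteq>\<^bsub>pointwise_order G S\<^esub> t" "t \<sqsubseteq>\<^bsub>pointwise_order G S\<^esub> s"
  then have "s = t"
    using assms by (intro extensionalityI[of s G t]) (auto simp: pointwise_order_def)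
  then show "s .=\<^bsub>pointwise_order G S\<^esub> t"
    by (simp add: pointwise_order_def)
qed (force simp: pointwise_order_def)+

text \<open>A bijection is an order isomorphism once it and its inverse are monotone; \<open>order_emb\<close> asks for
  an equivalence, whose reverse half is monotonicity of the inverse.\<close>

lemma order_isomorphic_pointwise_orderI:
  assumes "S \<subseteq> extensional G" "S' \<subseteq> extensional G'"
    and f: "\<And>s. s \<in> S \<Longrightarrow> f s \<in> S'" and g: "\<And>t. t \<in> S' \<Longrightarrow> g t \<in> S"
    and gf: "\<And>s. s \<in> S \<Longrightarrow> g (f s) = s" and fg: "\<And>t. t \<in> S' \<Longrightarrow> f (g t) = t"
    and f_mono: "\<And>s t J. \<lbrakk>s \<in> S; t \<in> S; \<forall>I\<in>G. s I \<subseteq> t I; J \<in> G'\<rbrakk> \<Longrightarrow> f s J \<subseteq> f t J"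
    and g_mono: "\<And>s t I. \<lbrakk>s \<in> S'; t \<in> S'; \<forall>J\<in>G'. s J \<subseteq> t J; I \<in> G\<rbrakk> \<Longrightarrow> g s I \<subseteq> g t I"
  shows "order_isomorphic (pointwise_order G S) (pointwise_order G' S')"
proof -
  have "bij_betw f S S'"
    by (rule bij_betw_byWitness[where f' = g]) (use f g gf fg in auto)
  moreover have "(\<forall>J\<in>G'. f s J \<subseteq> f t J) \<longleftrightarrow> (\<forall>I\<in>G. s I \<subseteq> t I)" if "s \<in> S" "t \<in> S" for s t
    using g_mono[of "f s" "f t"] f_mono[of s t] f gf that by metis
  ultimately show ?thesis
    using weak_partial_order_pointwise_order[OF assms(1)]
      weak_partial_order_pointwise_order[OF assms(2)]
    unfolding order_isomorphic_def order_emb_def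
    by (intro exI[of _ f]) (simp add: pointwise_order_def)
qed

lemma order_isomorphic_trans:
  assumes "order_isomorphic L M" "order_isomorphic M N"
  shows "order_isomorphic L N"
proof -
  obtain f g where f: "order_emb L M f" "bij_betw f (carrier L) (carrier M)"
    and g: "order_emb M N g" "bij_betw g (carrier M) (carrier N)"
    using assms unfolding order_isomorphic_def by blast
  have "order_emb L N (g \<circ> f)"
    using f g bij_betwE[OF f(2)] by (simp add: order_emb_def)
  then show ?thesis
    using bij_betw_trans[OF f(2) g(2)] unfolding order_isomorphic_def by blast
qed

lemma multiplicative_operationsI:
  assumes "s \<in> G \<rightarrow>\<^sub>E G" and "\<And>I. I \<in> G \<Longrightarrow> I \<subseteq> s I"
    and "\<And>I J. \<lbrakk>I \<in> G; J \<in> G; I \<subseteq> J\<rbrakk> \<Longrightarrow> s I \<subseteq> s J"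
    and "\<And>I. I \<in> G \<Longrightarrow> s (s I) = s I"
    and "\<And>I b. \<lbrakk>I \<in> G; b \<in> carrier B; residual B I b \<in> G\<rbrakk> \<Longrightarrow>
      s (residual B I b) \<subseteq> residual B (s I) b"
  shows "s \<in> multiplicative_operations B G"
  using assms by (auto simp: multiplicative_operations_def closure_operation_inclusion_order_iff)

lemma multiplicative_operationsD:
  assumes "s \<in> multiplicative_operations B G"
  shows "s \<in> G \<rightarrow>\<^sub>E G" and "I \<in> G \<Longrightarrow> s I \<in> G" and "I \<in> G \<Longrightarrow> I \<subseteq> s I"
    and "\<lbrakk>I \<in> G; J \<in> G; I \<subseteq> J\<rbrakk> \<Longrightarrow> s I \<subseteq> s J"
    and "I \<in> G \<Longrightarrow> s (s I) = s I"
    and "\<lbrakk>I \<in> G; b \<in> carrier B; residual B I b \<in> G\<rbrakk> \<Longrightarrow>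
      s (residual B I b) \<subseteq> residual B (s I) b"
  using assms by (auto simp: multiplicative_operations_def closure_operation_inclusion_order_iff)

lemma multiplicative_operations_extensional: "multiplicative_operations B G \<subseteq> extensional G"
  by (auto dest!: multiplicative_operationsD(1) simp: PiE_def)

section \<open>Submodules\<close>

lemma (in ring) submodules_iff:
  "I \<in> submodules A R \<longleftrightarrow> I \<subseteq> carrier R \<and> \<zero> \<in> I \<and> (\<forall>x\<in>I. \<forall>y\<in>I. x \<oplus> y \<in> I) \<and>
     (\<forall>x\<in>I. \<ominus> x \<in> I) \<and> (\<forall>a\<in>A. \<forall>x\<in>I. a \<otimes> x \<in> I)"
  by (auto simp: submodules_def subalgebra_def subgroup_def subalgebra_axioms_def a_inv_def)

lemma ideal_prod_mono:
  assumes "I \<subseteq> I'" "J \<subseteq> J'"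
  shows "I \<cdot>\<^bsub>R\<^esub> J \<subseteq> I' \<cdot>\<^bsub>R\<^esub> J'"
proof
  fix x assume "x \<in> I \<cdot>\<^bsub>R\<^esub> J"
  then show "x \<in> I' \<cdot>\<^bsub>R\<^esub> J'"
    by induction (use assms in \<open>auto intro: ideal_prod.intros\<close>)
qed

lemma (in ring) ideal_prod_subset_carrier:
  assumes "I \<subseteq> carrier R" "J \<subseteq> carrier R"
  shows "I \<cdot> J \<subseteq> carrier R"
proof
  fix x assume "x \<in> I \<cdot> J"
  then show "x \<in> carrier R"
    by induction (use assms in auto)
qed

lemma (in ring) subset_ideal_prod_carrier:
  assumes "I \<subseteq> carrier R"
  shows "I \<subseteq> I \<cdot> carrier R"
proof
  fix x assume "x \<in> I"
  then have "x \<otimes> \<one> \<in> I \<cdot> carrier R"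
    by (intro ideal_prod.prod) auto
  then show "x \<in> I \<cdot> carrier R"
    using assms \<open>x \<in> I\<close> by (simp add: subset_eq)
qed

text \<open>This is how membership in \<open>F0\<close> is obtained for closures and residuals: they contain a member.\<close>

lemma (in ring) F0_upward_closed:
  assumes "J \<in> F0 A R" "N \<in> submodules A R" "J \<subseteq> N"
  shows "N \<in> F0 A R"
  using assms ideal_prod_mono[of J N "carrier R" "carrier R" R]
    ideal_prod_subset_carrier[of N "carrier R"]
  by (auto simp: F0_def submodules_iff)

lemma (in cring) residual_submodule:
  assumes "N \<in> submodules A R" "b \<in> carrier R" "A \<subseteq> carrier R"
  shows "residual R N b \<in> submodules A R"
proof -
  have "b \<otimes> (a \<otimes> x) = a \<otimes> (b \<otimes> x)" if "a \<in> A" "x \<in> carrier R" for a x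
    using m_lcomm[of b a x] assms that by blast
  then show ?thesis
    using assms(1,2) subsetD[OF assms(3)] unfolding submodules_iff residual_def
    by (simp add: r_distr r_minus)
qed

text \<open>Brings principality of \<open>R\<close> to bear on submodules over a subring.\<close>

lemma (in cring) submodule_extension_ideal:
  assumes N: "N \<in> submodules A R"
  shows "ideal (N \<cdot> carrier R) R"
proof -
  have carr: "N \<subseteq> carrier R" "N \<cdot> carrier R \<subseteq> carrier R"
    using N ideal_prod_subset_carrier by (auto simp: submodules_iff)
  have smult: "r \<otimes> x \<in> N \<cdot> carrier R" if "x \<in> N \<cdot> carrier R" "r \<in> carrier R" for x r
    using that
  proof induction
    case (prod i j)
    have "i \<otimes> (r \<otimes> j) \<in> N \<cdot> carrier R"
      using prod by (intro ideal_prod.prod) auto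
    moreover have "r \<otimes> (i \<otimes> j) = i \<otimes> (r \<otimes> j)"
      using prod carr by (intro m_lcomm) auto
    ultimately show ?case
      by simp
  next
    case (sum x y)
    then show ?case
      using carr by (auto simp: r_distr subset_eq intro: ideal_prod.sum)
  qed
  have subgroup: "subgroup (N \<cdot> carrier R) (add_monoid R)"
  proof (rule add.subgroupI)
    show "N \<cdot> carrier R \<noteq> {}"
      using subset_ideal_prod_carrier[OF carr(1)] N by (auto simp: submodules_iff)
  next
    fix x assume x: "x \<in> N \<cdot> carrier R"
    then have "\<ominus> x = (\<ominus> \<one>) \<otimes> x"
      using subsetD[OF carr(2)] by (simp add: l_minus)
    then show "\<ominus> x \<in> N \<cdot> carrier R"
      using smult[OF x, of "\<ominus> \<one>"] by simp
  qed (use carr in \<open>auto intro: ideal_prod.sum\<close>)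
  have "x \<otimes> r \<in> N \<cdot> carrier R" if "x \<in> N \<cdot> carrier R" "r \<in> carrier R" for x r
    using smult[OF that] m_comm[of x r] subsetD[OF carr(2)] that by simp
  then show ?thesis
    using smult by (intro idealI[OF ring_axioms subgroup]) simp_all
qed

section \<open>Multiplicative operations under a surjective homomorphism\<close>

definition hom_preimage :: "('a, 'b) ring_scheme \<Rightarrow> ('a \<Rightarrow> 'c) \<Rightarrow> 'c set \<Rightarrow> 'a set"
  where "hom_preimage R h Y = {r \<in> carrier R. h r \<in> Y}"

context ring_hom_ring
begin

text \<open>The sets are arbitrary subsets because \<open>F0\<close> applies the product to submodules, not to ideals.\<close>

lemma image_ideal_prod:
  assumes "I \<subseteq> carrier R" "J \<subseteq> carrier R"
  shows "h ` (I \<cdot> J) = (h ` I) \<cdot>\<^bsub>S\<^esub> (h ` J)"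
proof (intro equalityI subsetI)
  fix y assume "y \<in> h ` (I \<cdot> J)"
  then obtain x where "x \<in> I \<cdot> J" "y = h x"
    by blast
  then show "y \<in> (h ` I) \<cdot>\<^bsub>S\<^esub> (h ` J)"
  proof (induction arbitrary: y)
    case (prod i j)
    then have "y = h i \<otimes>\<^bsub>S\<^esub> h j"
      using subsetD[OF assms(1)] subsetD[OF assms(2)] by simp
    then show ?case
      using prod by (auto intro: ideal_prod.prod)
  next
    case (sum x x')
    then have "y = h x \<oplus>\<^bsub>S\<^esub> h x'"
      using subsetD[OF R.ideal_prod_subset_carrier[OF assms]] by simp
    then show ?case
      using sum by (auto intro: ideal_prod.sum)
  qed
next
  fix y assume "y \<in> (h ` I) \<cdot>\<^bsub>S\<^esub> (h ` J)"
  then show "y \<in> h ` (I \<cdot> J)"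
  proof induction
    case (prod a b)
    then obtain i j where "i \<in> I" "j \<in> J" "a = h i" "b = h j"
      by blast
    then show ?case
      using subsetD[OF assms(1)] subsetD[OF assms(2)]
      by (intro image_eqI[of _ _ "i \<otimes> j"]) (simp_all add: ideal_prod.prod)
  next
    case (sum a b)
    then obtain x x' where "x \<in> I \<cdot> J" "x' \<in> I \<cdot> J" "a = h x" "b = h x'"
      by blast
    then show ?case
      using subsetD[OF R.ideal_prod_subset_carrier[OF assms]]
      by (intro image_eqI[of _ _ "x \<oplus> x'"]) (simp_all add: ideal_prod.sum)
  qed
qed

lemma diff_in_kernel:
  assumes "r \<in> carrier R" "p \<in> carrier R" "h r = h p"
  shows "r \<ominus> p \<in> a_kernel R S h" "(r \<ominus> p) \<oplus> p = r"
proof -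
  have "h (r \<ominus> p) = h p \<oplus>\<^bsub>S\<^esub> (\<ominus>\<^bsub>S\<^esub> h p)"
    using assms by (simp add: a_minus_def)
  also have "\<dots> = \<zero>\<^bsub>S\<^esub>"
    by (rule S.r_neg[OF hom_closed[OF assms(2)]])
  finally show "r \<ominus> p \<in> a_kernel R S h"
    unfolding a_kernel_def' using R.minus_closed[OF assms(1,2)] by blast
  show "(r \<ominus> p) \<oplus> p = r"
    unfolding a_minus_def R.a_assoc[OF assms(1) R.a_inv_closed[OF assms(2)] assms(2)]
    by (simp add: assms(1,2) R.l_neg)
qed

lemma preimage_image_submodule:
  assumes J: "J \<in> submodules A R" and ker: "a_kernel R S h \<subseteq> J"
  shows "hom_preimage R h (h ` J) = J"
proof
  show "hom_preimage R h (h ` J) \<subseteq> J"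
  proof
    fix r assume "r \<in> hom_preimage R h (h ` J)"
    then obtain j where j: "r \<in> carrier R" "j \<in> J" "h r = h j"
      by (auto simp: hom_preimage_def)
    have carr: "j \<in> carrier R"
      using J j by (auto simp: R.submodules_iff)
    then have "r \<ominus> j \<in> J"
      using j ker diff_in_kernel(1)[of r j] by blast
    then have "(r \<ominus> j) \<oplus> j \<in> J"
      using J j(2) unfolding R.submodules_iff by blast
    then show "r \<in> J"
      using j carr by (simp add: diff_in_kernel(2))
  qed
next
  have "J \<subseteq> carrier R"
    using J by (simp add: R.submodules_iff)
  then show "J \<subseteq> hom_preimage R h (h ` J)"
    by (auto simp: hom_preimage_def)
qed

lemma preimage_submodule:
  assumes "Y \<in> submodules (h ` A) S" "A \<subseteq> carrier R"
  shows "hom_preimage R h Y \<in> submodules A R"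
  using assms(1) subsetD[OF assms(2)] unfolding R.submodules_iff S.submodules_iff hom_preimage_def
  by (simp add: subset_iff)

lemma image_F0:
  assumes surj: "h ` carrier R = carrier S" and "A \<subseteq> carrier R" "J \<in> F0 A R"
  shows "h ` J \<in> F0 (h ` A) S"
proof -
  have J: "subalgebra A J R" "J \<cdot> carrier R = carrier R" "J \<subseteq> carrier R"
    using assms by (auto simp: F0_def submodules_def dest: R.subalgebra_in_carrier)
  then have "(h ` J) \<cdot>\<^bsub>S\<^esub> carrier S = carrier S"
    using image_ideal_prod[of J "carrier R"] surj by simp
  then show ?thesis
    using img_is_subalgebra[OF assms(2) J(1)] by (simp add: F0_def submodules_def)
qed

text \<open>An element \<open>r\<close> agrees modulo the kernel with some \<open>p \<in> JR\<close>, where \<open>J\<close> is the preimage; the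
  error \<open>r - p\<close> is harmless since the kernel lies in \<open>J\<close>.\<close>

lemma preimage_F0:
  assumes surj: "h ` carrier R = carrier S" and A: "A \<subseteq> carrier R" and Y: "Y \<in> F0 (h ` A) S"
  shows "hom_preimage R h Y \<in> F0 A R"
proof -
  let ?J = "hom_preimage R h Y"
  have Y': "Y \<in> submodules (h ` A) S" "Y \<cdot>\<^bsub>S\<^esub> carrier S = carrier S" "Y \<subseteq> carrier S"
    using Y by (auto simp: F0_def S.submodules_iff)
  have J: "?J \<in> submodules A R" "?J \<subseteq> carrier R" "h ` ?J = Y"
    using preimage_submodule[OF Y'(1) A] Y'(3) surj by (auto simp: hom_preimage_def)
  have "\<zero>\<^bsub>S\<^esub> \<in> Y"
    using Y'(1) by (simp add: S.submodules_iff)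
  then have "a_kernel R S h \<subseteq> ?J"
    unfolding a_kernel_def' hom_preimage_def by fastforce
  then have ker: "a_kernel R S h \<subseteq> ?J \<cdot> carrier R"
    using R.subset_ideal_prod_carrier[OF J(2)] by (rule subset_trans)
  have "r \<in> ?J \<cdot> carrier R" if r: "r \<in> carrier R" for r
  proof -
    have "h r \<in> h ` (?J \<cdot> carrier R)"
      using image_ideal_prod[OF J(2) subset_refl] J(3) Y'(2) surj r by auto
    then obtain p where p: "p \<in> ?J \<cdot> carrier R" "h r = h p"
      by blast
    then have "p \<in> carrier R"
      using R.ideal_prod_subset_carrier[OF J(2) subset_refl] by blast
    note diff = diff_in_kernel[OF r this p(2)]
    show ?thesis
      using ideal_prod.sum[OF subsetD[OF ker diff(1)] p(1)] unfolding diff(2) .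
  qed
  then show ?thesis
    using J R.ideal_prod_subset_carrier[OF J(2) subset_refl] by (auto simp: F0_def)
qed

lemma preimage_residual:
  assumes "b \<in> carrier R" "Y \<subseteq> carrier S"
  shows "hom_preimage R h (residual S Y (h b)) = residual R (hom_preimage R h Y) b"
  using assms by (auto simp: hom_preimage_def residual_def)

text \<open>Once every member of \<open>F0 A R\<close> contains the kernel, image and preimage are mutually inverse and
  monotone between the two sets \<open>F0\<close>. Operations are transported by conjugation, and the residual
  inequality survives because preimages commute with residuals and every element of \<open>S\<close> has the
  form \<open>h b\<close>.\<close>

theorem Mult0_surjective_image:
  assumes surj: "h ` carrier R = carrier S" and A: "A \<subseteq> carrier R"
    and ker: "\<And>J. J \<in> F0 A R \<Longrightarrow> a_kernel R S h \<subseteq> J"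
  shows "order_isomorphic (Mult0 A R) (Mult0 (h ` A) S)"
proof -
  let ?G = "F0 A R" and ?G' = "F0 (h ` A) S" and ?v = "hom_preimage R h"
  have im [simp]: "h ` J \<in> ?G'" if "J \<in> ?G" for J
    using image_F0[OF surj A that] .
  have pre [simp]: "?v Y \<in> ?G" if "Y \<in> ?G'" for Y
    using preimage_F0[OF surj A that] .
  have vim [simp]: "?v (h ` J) = J" if "J \<in> ?G" for J
    using preimage_image_submodule ker that unfolding F0_def by blast
  have surj_img: "h ` ?v Y = Y" if "Y \<subseteq> carrier S" for Y
    using surj that by (auto simp: hom_preimage_def)
  have carr: "Y \<subseteq> carrier S" if "Y \<in> ?G'" for Y
    using that by (auto simp: F0_def S.submodules_iff)
  have imv [simp]: "h ` ?v Y = Y" if "Y \<in> ?G'" for Y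
    by (rule surj_img[OF carr[OF that]])
  have v_mono: "?v Y \<subseteq> ?v Z" if "Y \<subseteq> Z" for Y Z
    using that by (auto simp: hom_preimage_def)
  have h_res: "residual S (h ` J) (h b) = h ` residual R J b"
    if "J \<in> ?G" "b \<in> carrier R" for J b
  proof -
    have "h ` ?v (residual S (h ` J) (h b)) = residual S (h ` J) (h b)"
      by (rule surj_img) (auto simp: residual_def)
    then show ?thesis
      using preimage_residual[OF that(2) carr[OF im[OF that(1)]]] that(1) by simp
  qed
  define f where "f s = (\<lambda>Y\<in>?G'. h ` s (?v Y))" for s
  define g where "g t = (\<lambda>J\<in>?G. ?v (t (h ` J)))" for t
  have f: "f s \<in> multiplicative_operations S ?G'" if s: "s \<in> multiplicative_operations R ?G" for s
  proof (rule multiplicative_operationsI)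
    note s_in [simp] = multiplicative_operationsD(2)[OF s]
    show "f s \<in> ?G' \<rightarrow>\<^sub>E ?G'"
      by (auto simp: f_def)
    fix Y assume Y: "Y \<in> ?G'"
    show "Y \<subseteq> f s Y"
      using image_mono[OF multiplicative_operationsD(3)[OF s pre[OF Y]], of h] Y by (simp add: f_def)
    show "f s (f s Y) = f s Y"
      using Y multiplicative_operationsD(5)[OF s] by (simp add: f_def)
    show "f s Y \<subseteq> f s Z" if "Z \<in> ?G'" "Y \<subseteq> Z" for Z
      using Y that multiplicative_operationsD(4)[OF s _ _ v_mono] by (simp add: f_def image_mono)
    fix c assume "c \<in> carrier S" and res: "residual S Y c \<in> ?G'"
    then obtain b where b: "b \<in> carrier R" "c = h b"
      using surj by blast
    have "?v (residual S Y c) = residual R (?v Y) b"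
      using preimage_residual[OF b(1) carr[OF Y]] b by simp
    moreover from this have "s (residual R (?v Y) b) \<subseteq> residual R (s (?v Y)) b"
      using multiplicative_operationsD(6)[OF s pre[OF Y] b(1)] pre[OF res] by simp
    ultimately show "f s (residual S Y c) \<subseteq> residual S (f s Y) c"
      using Y res b h_res[of "s (?v Y)" b] by (auto simp: f_def)
  qed
  have g: "g t \<in> multiplicative_operations R ?G" if t: "t \<in> multiplicative_operations S ?G'" for t
  proof (rule multiplicative_operationsI)
    note t_in [simp] = multiplicative_operationsD(2)[OF t]
    show "g t \<in> ?G \<rightarrow>\<^sub>E ?G"
      by (auto simp: g_def)
    fix J assume J: "J \<in> ?G"
    show "J \<subseteq> g t J"
      using v_mono[OF multiplicative_operationsD(3)[OF t im[OF J]]] J by (simp add: g_def)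
    show "g t (g t J) = g t J"
      using J multiplicative_operationsD(5)[OF t] by (simp add: g_def)
    show "g t J \<subseteq> g t N" if "N \<in> ?G" "J \<subseteq> N" for N
      using J that multiplicative_operationsD(4)[OF t im[OF J] im[OF that(1)] image_mono[OF that(2)]]
      by (simp add: g_def v_mono)
    fix b assume b: "b \<in> carrier R" and res: "residual R J b \<in> ?G"
    have "t (h ` residual R J b) \<subseteq> residual S (t (h ` J)) (h b)"
      using multiplicative_operationsD(6)[OF t im[OF J] hom_closed[OF b]] im[OF res]
      unfolding h_res[OF J b] by blast
    then have "?v (t (h ` residual R J b)) \<subseteq> ?v (residual S (t (h ` J)) (h b))"
      by (rule v_mono)
    then show "g t (residual R J b) \<subseteq> residual R (g t J) b"
      unfolding preimage_residual[OF b carr[OF t_in[OF im[OF J]]]] using J res by (simp add: g_def)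
  qed
  show ?thesis
    unfolding Mult0_def Mult_def
  proof (rule order_isomorphic_pointwise_orderI[where f = f and g = g])
    show "g (f s) = s" if s: "s \<in> multiplicative_operations R ?G" for s
      by (rule extensionalityI[of _ ?G])
        (use s multiplicative_operationsD(2)[OF s] multiplicative_operations_extensional
          in \<open>auto simp: f_def g_def\<close>)
    show "f (g t) = t" if t: "t \<in> multiplicative_operations S ?G'" for t
      by (rule extensionalityI[of _ ?G'])
        (use t multiplicative_operationsD(2)[OF t] multiplicative_operations_extensional
          in \<open>auto simp: f_def g_def\<close>)
  qed (use f g v_mono in \<open>auto simp: f_def g_def multiplicative_operations_extensional image_mono\<close>)
qed

end

section \<open>Fractional ideals and a principal overring\<close>

lemma l_coset_image: "x <#\<^bsub>G\<^esub> N = (\<lambda>y. x \<otimes>\<^bsub>G\<^esub> y) ` N"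
  by (auto simp: l_coset_def)

lemma l_coset_mono: "M \<subseteq> N \<Longrightarrow> x <#\<^bsub>G\<^esub> M \<subseteq> x <#\<^bsub>G\<^esub> N"
  by (auto simp: l_coset_def)

lemma (in monoid) l_coset_assoc:
  assumes "x \<in> carrier G" "y \<in> carrier G" "N \<subseteq> carrier G"
  shows "x <# (y <# N) = (x \<otimes> y) <# N"
  using assms by (force simp: l_coset_image m_assoc)

lemma (in monoid) l_coset_one: "N \<subseteq> carrier G \<Longrightarrow> \<one> <# N = N"
  by (force simp: l_coset_image)

lemma fractional_star_operationsI:
  assumes "s \<in> fractional_ideals K D \<rightarrow>\<^sub>E fractional_ideals K D"
    and "\<And>I. I \<in> fractional_ideals K D \<Longrightarrow> I \<subseteq> s I"
    and "\<And>I J. \<lbrakk>I \<in> fractional_ideals K D; J \<in> fractional_ideals K D; I \<subseteq> J\<rbrakk> \<Longrightarrow> s I \<subseteq> s J"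
    and "\<And>I. I \<in> fractional_ideals K D \<Longrightarrow> s (s I) = s I"
    and "\<And>x I. \<lbrakk>x \<in> carrier K; I \<in> fractional_ideals K D\<rbrakk> \<Longrightarrow> x <#\<^bsub>K\<^esub> s I = s (x <#\<^bsub>K\<^esub> I)"
  shows "s \<in> fractional_star_operations K D"
  using assms by (auto simp: fractional_star_operations_def closure_operation_inclusion_order_iff)

lemma fractional_star_operationsD:
  assumes "s \<in> fractional_star_operations K D"
  shows "s \<in> fractional_ideals K D \<rightarrow>\<^sub>E fractional_ideals K D"
    and "I \<in> fractional_ideals K D \<Longrightarrow> s I \<in> fractional_ideals K D"
    and "I \<in> fractional_ideals K D \<Longrightarrow> I \<subseteq> s I"
    and "\<lbrakk>I \<in> fractional_ideals K D; J \<in> fractional_ideals K D; I \<subseteq> J\<rbrakk> \<Longrightarrow> s I \<subseteq> s J"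
    and "I \<in> fractional_ideals K D \<Longrightarrow> s (s I) = s I"
    and "\<lbrakk>x \<in> carrier K; I \<in> fractional_ideals K D\<rbrakk> \<Longrightarrow> x <#\<^bsub>K\<^esub> s I = s (x <#\<^bsub>K\<^esub> I)"
  using assms by (auto simp: fractional_star_operations_def closure_operation_inclusion_order_iff)

locale principal_overring =
  fixes K :: "('a, 'b) ring_scheme" (structure) and D T :: "'a set"
  assumes quotient_field: "quotient_field K D"
    and subring_T: "subring T K" and D_sub_T: "D \<subseteq> T"
    and principal_T: "principal_domain (K\<lparr>carrier := T\<rparr>)"
    and conductor_nonzero: "conductor K D T \<noteq> {\<zero>}"
begin

sublocale field K
  using quotient_field by (simp add: quotient_field_def)

abbreviation "B \<equiv> K\<lparr>carrier := T\<rparr>"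

sublocale B: principal_domain B
  by (rule principal_T)

lemma subring_D: "subring D K"
  using quotient_field by (simp add: quotient_field_def subdomain_def subcring_def)

lemma T_closed [simp]:
  "T \<subseteq> carrier K" "\<zero> \<in> T" "\<one> \<in> T"
  "\<lbrakk>x \<in> T; y \<in> T\<rbrakk> \<Longrightarrow> x \<oplus> y \<in> T" "\<lbrakk>x \<in> T; y \<in> T\<rbrakk> \<Longrightarrow> x \<otimes> y \<in> T" "x \<in> T \<Longrightarrow> \<ominus> x \<in> T"
  using subringE[OF subring_T] by auto

lemma D_closed [simp]:
  "D \<subseteq> carrier K" "\<zero> \<in> D" "\<one> \<in> D"
  "\<lbrakk>x \<in> D; y \<in> D\<rbrakk> \<Longrightarrow> x \<oplus> y \<in> D" "\<lbrakk>x \<in> D; y \<in> D\<rbrakk> \<Longrightarrow> x \<otimes> y \<in> D" "x \<in> D \<Longrightarrow> \<ominus> x \<in> D"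
  using subringE[OF subring_D] by auto

lemma in_carrier [simp]: "x \<in> T \<Longrightarrow> x \<in> carrier K" "x \<in> D \<Longrightarrow> x \<in> carrier K"
  using T_closed(1) D_closed(1) by blast+

text \<open>Members of \<open>F0 D B\<close> can therefore be handled as submodules of the field, where scaling by
  inverses makes sense.\<close>

lemma submodules_overring: "submodules D B = {J \<in> submodules D K. J \<subseteq> T}"
proof -
  have "subgroup J (add_monoid B) \<longleftrightarrow> subgroup J (add_monoid K) \<and> J \<subseteq> T" for J
    using add.subgroup_incl[of J T] add.incl_subgroup[of T J] subring_T subgroup.subset[of J "add_monoid B"]
    by (auto simp: subring_def)
  then show ?thesis
    by (auto simp: submodules_def subalgebra_def subalgebra_axioms_def)
qed

lemma submodule_scale:
  assumes "N \<in> submodules D K" "x \<in> carrier K"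
  shows "x <# N \<in> submodules D K"
proof -
  have N: "N \<subseteq> carrier K" "\<zero> \<in> N" "\<forall>y\<in>N. \<forall>z\<in>N. y \<oplus> z \<in> N" "\<forall>y\<in>N. \<ominus> y \<in> N"
    "\<forall>d\<in>D. \<forall>y\<in>N. d \<otimes> y \<in> N"
    using assms(1) by (auto simp: submodules_iff)
  show ?thesis
    unfolding submodules_iff
  proof (intro conjI ballI)
    show "\<zero> \<in> x <# N"
      using N(2) assms(2) by (auto simp: l_coset_image intro!: image_eqI[of _ _ \<zero>])
    fix y assume "y \<in> x <# N"
    then obtain n where n: "n \<in> N" "y = x \<otimes> n" "n \<in> carrier K"
      using N(1) by (auto simp: l_coset_image)
    show "\<ominus> y \<in> x <# N"
      using n N(4) assms(2) by (auto simp: l_coset_image r_minus intro!: image_eqI[of _ _ "\<ominus> n"])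
    show "d \<otimes> y \<in> x <# N" if "d \<in> D" for d
      using n N(5) assms(2) that
      by (auto simp: l_coset_image m_lcomm intro!: image_eqI[of _ _ "d \<otimes> n"])
    fix z assume "z \<in> x <# N"
    then obtain m where "m \<in> N" "z = x \<otimes> m" "m \<in> carrier K"
      using N(1) by (auto simp: l_coset_image)
    then show "y \<oplus> z \<in> x <# N"
      using n N(3) assms(2) by (auto simp: l_coset_image r_distr intro!: image_eqI[of _ _ "n \<oplus> m"])
  qed (use N(1) assms(2) in \<open>auto simp: l_coset_image\<close>)
qed

lemma F0_D:
  assumes "J \<in> F0 D B"
  shows "J \<in> submodules D K" "J \<in> submodules D B" "J \<subseteq> T" "J \<subseteq> carrier K" "J \<cdot>\<^bsub>B\<^esub> T = T"
  using assms submodules_overring T_closed(1) by (auto simp: F0_def)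

lemma T_in_F0: "T \<in> F0 D B"
proof -
  have "T \<in> submodules D B"
    using D_sub_T unfolding submodules_overring submodules_iff by auto
  then show ?thesis
    using B.subset_ideal_prod_carrier[of T] B.ideal_prod_subset_carrier[of T T]
    by (simp add: F0_def)
qed

lemma conductor_witness:
  obtains c where "c \<in> D" "c \<noteq> \<zero>" "\<And>t. t \<in> T \<Longrightarrow> c \<otimes> t \<in> D"
proof -
  have "\<zero> \<in> conductor K D T"
    by (auto simp: conductor_def)
  then obtain c where "c \<in> conductor K D T" "c \<noteq> \<zero>"
    using conductor_nonzero by blast
  then show thesis
    using that[of c] T_closed(3) unfolding conductor_def by fastforce
qed

text \<open>If \<open>x = p/q\<close> and \<open>cT \<subseteq> D\<close>, then \<open>qc\<close> is a common denominator: \<open>qc \<cdot> xJ = p \<cdot> cJ \<subseteq> D\<close>.\<close>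

lemma scaled_F0_fractional:
  assumes J: "J \<in> F0 D B" and x: "x \<in> carrier K"
  shows "x <# J \<in> fractional_ideals K D"
proof -
  obtain p q where pq: "p \<in> D" "q \<in> D" "q \<noteq> \<zero>" "x = p \<otimes> inv q"
    using quotient_field x unfolding quotient_field_def by blast
  obtain c where c: "c \<in> D" "c \<noteq> \<zero>" "\<And>t. t \<in> T \<Longrightarrow> c \<otimes> t \<in> D"
    using conductor_witness by blast
  have iq: "inv q \<in> carrier K" "q \<otimes> inv q = \<one>"
    using pq by (auto simp: field_Units)
  have "(q \<otimes> c) <# (x <# J) \<subseteq> D"
  proof
    fix y assume "y \<in> (q \<otimes> c) <# (x <# J)"
    then obtain j where j: "j \<in> J" "y = (q \<otimes> c) \<otimes> (x \<otimes> j)"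
      by (auto simp: l_coset_image)
    have jT: "j \<in> T"
      using j F0_D(3)[OF J] by blast
    have "y = (q \<otimes> inv q) \<otimes> (p \<otimes> (c \<otimes> j))"
      using j jT pq c(1) iq(1) in_carrier by (simp add: m_ac)
    also have "\<dots> = p \<otimes> (c \<otimes> j)"
      using iq jT pq c(1) by simp
    finally show "y \<in> D"
      using c(3)[OF jT] pq by simp
  qed
  moreover have "q \<otimes> c \<in> D - {\<zero>}"
    using pq c integral[of q c] by auto
  ultimately show ?thesis
    using submodule_scale[OF F0_D(1)[OF J] x] unfolding fractional_ideals_def by blast
qed

lemma fractional_ideal_carrier: "F \<in> fractional_ideals K D \<Longrightarrow> F \<subseteq> carrier K"
  by (auto simp: fractional_ideals_def submodules_iff)

lemma inv_nonzero [simp]: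
  assumes "x \<in> carrier K" "x \<noteq> \<zero>"
  shows "inv x \<in> carrier K" "inv x \<otimes> x = \<one>" "x \<otimes> inv x = \<one>" "inv x \<noteq> \<zero>"
proof -
  have u: "x \<in> Units K"
    using assms by (simp add: field_Units)
  then show "inv x \<in> carrier K" "inv x \<otimes> x = \<one>" "x \<otimes> inv x = \<one>"
    by auto
  then show "inv x \<noteq> \<zero>"
    using assms by (metis r_null one_not_zero)
qed

lemma l_coset_cancel:
  assumes "x \<in> carrier K" "x \<noteq> \<zero>" "N \<subseteq> carrier K"
  shows "inv x <# (x <# N) = N" "x <# (inv x <# N) = N"
  using assms by (simp_all add: l_coset_assoc l_coset_one)

text \<open>Clear denominators to get \<open>N = dF \<subseteq> D\<close>. The ideal \<open>NT\<close> of \<open>T\<close> is generated by some \<open>a\<close>, and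
  dividing by it normalizes: \<open>J = a\<inverse>N\<close> satisfies \<open>JT = a\<inverse>NT = T\<close>, while \<open>F = (a/d)J\<close>.\<close>

lemma fractional_ideal_factor:
  assumes F: "F \<in> fractional_ideals K D" "F \<noteq> {\<zero>}"
  obtains x J where "x \<in> carrier K" "x \<noteq> \<zero>" "J \<in> F0 D B" "F = x <# J"
proof -
  obtain d where d: "d \<in> D" "d \<noteq> \<zero>" "d <# F \<subseteq> D" and Fs: "F \<in> submodules D K"
    using F(1) by (auto simp: fractional_ideals_def)
  have Fc: "F \<subseteq> carrier K" "\<zero> \<in> F"
    using Fs by (auto simp: submodules_iff)
  define N where "N = d <# F"
  have N: "N \<in> submodules D K" "N \<subseteq> T"
    using submodule_scale[OF Fs] d D_sub_T by (auto simp: N_def)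
  then have NB: "N \<in> submodules D B"
    by (simp add: submodules_overring)
  have Nc: "N \<subseteq> carrier K"
    using N(2) T_closed(1) by blast
  have NF: "F = inv d <# N"
    using l_coset_cancel(1)[OF _ d(2) Fc(1)] d by (simp add: N_def)
  obtain a where a: "a \<in> T" "N \<cdot>\<^bsub>B\<^esub> T = PIdl\<^bsub>B\<^esub> a"
    using B.exists_gen[OF B.submodule_extension_ideal[OF NB]] by auto
  have prod_a: "N \<cdot>\<^bsub>B\<^esub> T = {t \<otimes> a |t. t \<in> T}"
    unfolding a(2) cgenideal_def by simp
  have N_sub: "N \<subseteq> N \<cdot>\<^bsub>B\<^esub> T"
    using B.subset_ideal_prod_carrier[of N] N(2) by simp
  have a0: "a \<noteq> \<zero>"
  proof
    assume "a = \<zero>"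
    then have "N \<subseteq> {\<zero>}"
      using N_sub prod_a by auto
    then have "F \<subseteq> {\<zero>}"
      using d unfolding NF by (auto simp: l_coset_image)
    then show False
      using F(2) Fc(2) by blast
  qed
  define J where "J = inv a <# N"
  have ac: "a \<in> carrier K"
    using a by simp
  have J_T: "J \<subseteq> T"
  proof
    fix y assume "y \<in> J"
    then obtain n where n: "n \<in> N" "y = inv a \<otimes> n"
      by (auto simp: J_def l_coset_image)
    then obtain t where t: "t \<in> T" "n = t \<otimes> a"
      using N_sub prod_a by blast
    have "y = (inv a \<otimes> a) \<otimes> t"
      using n t a0 ac by (simp add: m_ac del: inv_nonzero(2,3))
    then show "y \<in> T"
      using t a0 ac by simp
  qed
  \<comment> \<open>Membership in \<open>T\<close> is carried along so that the elements stay in the carrier for distributivity.\<close>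
  have scaled: "inv a \<otimes> y \<in> J \<cdot>\<^bsub>B\<^esub> T \<and> y \<in> T" if "y \<in> N \<cdot>\<^bsub>B\<^esub> T" for y
    using that
  proof induction
    case (prod i j)
    have "(inv a \<otimes> i) \<otimes>\<^bsub>B\<^esub> j \<in> J \<cdot>\<^bsub>B\<^esub> T"
      using prod by (intro ideal_prod.prod) (auto simp: J_def l_coset_image)
    then show ?case
      using prod N(2) a0 ac by (auto simp: m_assoc subset_eq)
  next
    case (sum y z)
    then have "(inv a \<otimes> y) \<oplus>\<^bsub>B\<^esub> (inv a \<otimes> z) \<in> J \<cdot>\<^bsub>B\<^esub> T"
      by (intro ideal_prod.sum) auto
    then show ?case
      using sum a0 ac by (auto simp: r_distr)
  qed
  have "T \<subseteq> J \<cdot>\<^bsub>B\<^esub> T"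
  proof
    fix t assume t: "t \<in> T"
    then have "inv a \<otimes> (t \<otimes> a) \<in> J \<cdot>\<^bsub>B\<^esub> T"
      using scaled[of "t \<otimes> a"] prod_a by blast
    moreover have "inv a \<otimes> (t \<otimes> a) = (inv a \<otimes> a) \<otimes> t"
      using t a0 ac by (simp add: m_ac del: inv_nonzero(2,3))
    ultimately show "t \<in> J \<cdot>\<^bsub>B\<^esub> T"
      using t a0 ac by simp
  qed
  moreover have "J \<in> submodules D B"
    using submodule_scale[OF N(1)] a0 ac J_T by (simp add: J_def submodules_overring)
  ultimately have J: "J \<in> F0 D B"
    using B.ideal_prod_subset_carrier[of J T] J_T by (auto simp: F0_def)
  have "F = inv d <# (a <# J)"
    using NF l_coset_cancel(2)[OF ac a0 Nc] by (simp add: J_def)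
  also have "\<dots> = (inv d \<otimes> a) <# J"
    using d ac F0_D(4)[OF J] by (intro l_coset_assoc) auto
  finally show thesis
    using that[of "inv d \<otimes> a" J] J d ac a0 integral[of "inv d" a] by auto
qed

lemma F0_ne_zero: "J \<in> F0 D B \<Longrightarrow> J \<noteq> {\<zero>}"
proof
  assume J: "J \<in> F0 D B" and "J = {\<zero>}"
  have "y = \<zero>" if "y \<in> {\<zero>} \<cdot>\<^bsub>B\<^esub> T" for y
    using that by induction auto
  then have "\<one> = \<zero>"
    using F0_D(5)[OF J] \<open>J = {\<zero>}\<close> T_closed(3) by blast
  then show False
    by simp
qed

lemma scaled_F0_ne_zero:
  assumes "J \<in> F0 D B" "x \<in> carrier K" "x \<noteq> \<zero>"
  shows "x <# J \<noteq> {\<zero>}"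
proof
  assume "x <# J = {\<zero>}"
  then have "J = inv x <# {\<zero>}"
    using l_coset_cancel(1)[OF assms(2,3) F0_D(4)[OF assms(1)]] by simp
  then show False
    using F0_ne_zero[OF assms(1)] assms(2,3) by (simp add: l_coset_image)
qed

text \<open>Put \<open>b = x/y\<close>. Then \<open>bJ \<subseteq> J' \<subseteq> T\<close>, so \<open>bT = bJT \<subseteq> T\<close>, which puts \<open>b\<close> in \<open>T\<close> and makes the
  residual \<open>(J' : b)\<close> available.\<close>

lemma scaled_F0_subset:
  assumes J: "J \<in> F0 D B" and J': "J' \<in> F0 D B"
    and x: "x \<in> carrier K" and y: "y \<in> carrier K" "y \<noteq> \<zero>"
    and sub: "x <# J \<subseteq> y <# J'"
  obtains b where "b \<in> T" "x = y \<otimes> b" "J \<subseteq> residual B J' b" "residual B J' b \<in> F0 D B"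
proof -
  define b where "b = inv y \<otimes> x"
  have b: "b \<in> carrier K"
    using x y by (simp add: b_def)
  have xyb: "x = y \<otimes> b"
    using x y by (simp add: b_def m_assoc[symmetric])
  have "b <# J = inv y <# (x <# J)"
    using x y F0_D(4)[OF J] by (simp add: b_def l_coset_assoc)
  also have "\<dots> \<subseteq> inv y <# (y <# J')"
    by (rule l_coset_mono[OF sub])
  also have "\<dots> = J'"
    using l_coset_cancel(1)[OF y F0_D(4)[OF J']] .
  finally have bJ: "b \<otimes> j \<in> J'" if "j \<in> J" for j
    using that by (auto simp: l_coset_image)
  \<comment> \<open>Since \<open>JT\<close> contains \<open>\<one>\<close>, the inclusion \<open>b JT \<subseteq> T\<close> gives \<open>b \<in> T\<close>.\<close>
  have "b \<otimes> z \<in> T \<and> z \<in> T" if "z \<in> J \<cdot>\<^bsub>B\<^esub> T" for z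
    using that
  proof induction
    case (prod i j)
    have "i \<in> T" "b \<otimes> i \<in> T"
      using prod(1) bJ F0_D(3)[OF J] F0_D(3)[OF J'] by auto
    then show ?case
      using prod b m_assoc[of b i j, symmetric] by auto
  next
    case (sum z w)
    then show ?case
      using b by (auto simp: r_distr)
  qed
  from this[of \<one>] have bT: "b \<in> T"
    using F0_D(5)[OF J] b by simp
  have sub': "J \<subseteq> residual B J' b"
    using bJ F0_D(3)[OF J] by (auto simp: residual_def)
  then have "residual B J' b \<in> F0 D B"
    using B.F0_upward_closed[OF J _ sub'] B.residual_submodule[OF F0_D(2)[OF J'], of b] bT D_sub_T
    by simp
  then show thesis
    using that bT xyb sub' by blast
qed

section \<open>Star operations from multiplicative operations\<close>

text \<open>The map \<open>xJ \<mapsto> x s(J)\<close> is monotone; applied in both directions to \<open>xJ = yJ'\<close> this also shows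
  that its value does not depend on the chosen factorization.\<close>

lemma scaled_operation_mono:
  assumes s: "s \<in> multiplicative_operations B (F0 D B)"
    and J: "J \<in> F0 D B" and J': "J' \<in> F0 D B"
    and x: "x \<in> carrier K" and y: "y \<in> carrier K" "y \<noteq> \<zero>"
    and sub: "x <# J \<subseteq> y <# J'"
  shows "x <# s J \<subseteq> y <# s J'"
proof -
  obtain b where b: "b \<in> T" "x = y \<otimes> b" "J \<subseteq> residual B J' b" "residual B J' b \<in> F0 D B"
    using scaled_F0_subset[OF J J' x y sub] by blast
  have "s J \<subseteq> s (residual B J' b)"
    using multiplicative_operationsD(4)[OF s J b(4,3)] .
  also have "\<dots> \<subseteq> residual B (s J') b"
    using multiplicative_operationsD(6)[OF s J' _ b(4)] b(1) by simp
  finally have "b <# s J \<subseteq> s J'"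
    by (auto simp: residual_def l_coset_image)
  then have "y <# (b <# s J) \<subseteq> y <# s J'"
    by (rule l_coset_mono)
  then show ?thesis
    using b y F0_D(4)[OF multiplicative_operationsD(2)[OF s J]] by (simp add: l_coset_assoc)
qed

text \<open>The union avoids a choice of factorization: all sets in it coincide. The zero ideal is treated
  apart because it has no factorization \<open>xJ\<close> with \<open>x \<noteq> \<zero>\<close>.\<close>

definition star_extension :: "('a set \<Rightarrow> 'a set) \<Rightarrow> 'a set \<Rightarrow> 'a set"
  where "star_extension s = (\<lambda>F\<in>fractional_ideals K D. if F = {\<zero>} then {\<zero>} else
    \<Union>{x <# s J |x J. x \<in> carrier K - {\<zero>} \<and> J \<in> F0 D B \<and> F = x <# J})"

lemma zero_fractional: "{\<zero>} \<in> fractional_ideals K D"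
proof -
  have "\<one> <# {\<zero>} \<subseteq> D" "\<one> \<in> D - {\<zero>}"
    by (auto simp: l_coset_image)
  moreover have "{\<zero>} \<in> submodules D K"
    by (auto simp: submodules_iff)
  ultimately show ?thesis
    unfolding fractional_ideals_def by blast
qed

lemma star_extension_zero [simp]: "star_extension s {\<zero>} = {\<zero>}"
  using zero_fractional by (simp add: star_extension_def)

lemma star_extension_scaled:
  assumes s: "s \<in> multiplicative_operations B (F0 D B)"
    and J: "J \<in> F0 D B" and x: "x \<in> carrier K" "x \<noteq> \<zero>"
  shows "star_extension s (x <# J) = x <# s J"
proof -
  have "y <# s J' = x <# s J"
    if "J' \<in> F0 D B" "y \<in> carrier K" "y \<noteq> \<zero>" "x <# J = y <# J'" for y J'
    using scaled_operation_mono[OF s J that(1) x(1) that(2,3)]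
      scaled_operation_mono[OF s that(1) J that(2) x] that(4) by blast
  then have "{y <# s J' |y J'. y \<in> carrier K - {\<zero>} \<and> J' \<in> F0 D B \<and> x <# J = y <# J'}
      = {x <# s J}"
    using J x by blast
  then show ?thesis
    using scaled_F0_ne_zero[OF J x] scaled_F0_fractional[OF J x(1)]
    by (simp add: star_extension_def)
qed

lemma fractional_ideal_cases:
  assumes "F \<in> fractional_ideals K D"
  obtains "F = {\<zero>}"
  | x J where "x \<in> carrier K" "x \<noteq> \<zero>" "J \<in> F0 D B" "F = x <# J"
  using assms fractional_ideal_factor by blast

lemma star_extension_star_operation:
  assumes s: "s \<in> multiplicative_operations B (F0 D B)"
  shows "star_extension s \<in> fractional_star_operations K D"
proof (rule fractional_star_operationsI)
  note s_in = multiplicative_operationsD(2)[OF s]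
  note ext = star_extension_scaled[OF s]
  have "star_extension s F \<in> fractional_ideals K D" if "F \<in> fractional_ideals K D" for F
    using that by (rule fractional_ideal_cases)
      (use zero_fractional scaled_F0_fractional s_in ext in auto)
  then show "star_extension s \<in> fractional_ideals K D \<rightarrow>\<^sub>E fractional_ideals K D"
    by (auto simp: star_extension_def)
  show extensive: "F \<subseteq> star_extension s F" if "F \<in> fractional_ideals K D" for F
    using that
  proof (rule fractional_ideal_cases)
    fix x J assume x: "x \<in> carrier K" "x \<noteq> \<zero>" and J: "J \<in> F0 D B" and "F = x <# J"
    then show ?thesis
      using ext[OF J x] l_coset_mono[OF multiplicative_operationsD(3)[OF s J]] by simp
  qed simp
  fix F assume F: "F \<in> fractional_ideals K D"
  from F show "star_extension s (star_extension s F) = star_extension s F"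
    by (rule fractional_ideal_cases)
      (use multiplicative_operationsD(5)[OF s] s_in ext in auto)
  show "x <# star_extension s F = star_extension s (x <# F)" if x: "x \<in> carrier K" for x
    using F
  proof (rule fractional_ideal_cases)
    assume "F = {\<zero>}"
    then show ?thesis
      using x by (simp add: l_coset_image)
  next
    fix y J assume y: "y \<in> carrier K" "y \<noteq> \<zero>" and J: "J \<in> F0 D B" and F_eq: "F = y <# J"
    have assoc: "x <# (y <# N) = (x \<otimes> y) <# N" if "N \<in> F0 D B" for N
      using l_coset_assoc[OF x y(1) F0_D(4)[OF that]] .
    show ?thesis
    proof (cases "x = \<zero>")
      case True
      have "\<zero> <# N = {\<zero>}" if "N \<in> submodules D K" for N
        using that by (force simp: l_coset_image submodules_iff)
      then have "\<zero> <# (y <# N) = {\<zero>}" if "N \<in> F0 D B" for N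
        using submodule_scale[OF F0_D(1)[OF that] y(1)] by blast
      then show ?thesis
        using True F_eq ext[OF J y] J s_in by simp
    next
      case False
      then have "x \<otimes> y \<noteq> \<zero>"
        using x y integral by blast
      then show ?thesis
        using F_eq ext[OF J y] ext[OF J, of "x \<otimes> y"] J s_in assoc x y by simp
    qed
  qed
  fix F' assume F': "F' \<in> fractional_ideals K D" and sub: "F \<subseteq> F'"
  show "star_extension s F \<subseteq> star_extension s F'"
    using F
  proof (rule fractional_ideal_cases)
    assume "F = {\<zero>}"
    then show ?thesis
      using sub extensive[OF F'] by auto
  next
    fix x J assume x: "x \<in> carrier K" "x \<noteq> \<zero>" and J: "J \<in> F0 D B" and F_eq: "F = x <# J"
    show ?thesis
      using F'
    proof (rule fractional_ideal_cases)
      assume "F' = {\<zero>}"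
      then have "x <# J = {\<zero>}"
        using sub F_eq submodule_scale[OF F0_D(1)[OF J] x(1)] by (auto simp: submodules_iff)
      then show ?thesis
        using scaled_F0_ne_zero[OF J x] by simp
    next
      fix y J' assume "y \<in> carrier K" "y \<noteq> \<zero>" "J' \<in> F0 D B" "F' = y <# J'"
      then show ?thesis
        using scaled_operation_mono[OF s J _ x(1)] sub ext J x F_eq by simp
    qed
  qed
qed

lemma F0_fractional: "J \<in> F0 D B \<Longrightarrow> J \<in> fractional_ideals K D"
  using scaled_F0_fractional[of J \<one>] l_coset_one F0_D(4) by simp

text \<open>As \<open>t s(T) = s(tT) \<subseteq> s(T)\<close>, the closure \<open>s(T)\<close> is a \<open>T\<close>-module, so its normalized factor is \<open>T\<close>
  and \<open>s(T) = xT\<close>. Idempotence yields \<open>xT = s(xT) = x s(T) = x\<^sup>2T\<close>, and cancelling \<open>x\<close> leaves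
  \<open>s(T) = T\<close>.\<close>

lemma star_fixes_overring:
  assumes s: "s \<in> fractional_star_operations K D"
  shows "s T = T"
proof -
  have T: "T \<in> fractional_ideals K D"
    using F0_fractional[OF T_in_F0] .
  have sT: "s T \<in> fractional_ideals K D" "T \<subseteq> s T"
    using fractional_star_operationsD(2,3)[OF s T] .
  then have "s T \<noteq> {\<zero>}"
    using T_closed(3) one_not_zero by blast
  then obtain x J where x: "x \<in> carrier K" "x \<noteq> \<zero>" and J: "J \<in> F0 D B" and sT_eq: "s T = x <# J"
    using fractional_ideal_factor[OF sT(1)] by blast
  have T_smult: "t \<otimes> y \<in> s T" if "t \<in> T" "y \<in> s T" for t y
  proof -
    have "t <# T \<subseteq> T"
      using that by (auto simp: l_coset_image)
    moreover have "t <# T \<in> fractional_ideals K D"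
      using scaled_F0_fractional[OF T_in_F0] that by simp
    ultimately have "s (t <# T) \<subseteq> s T"
      using fractional_star_operationsD(4)[OF s _ T] by blast
    then have "t <# s T \<subseteq> s T"
      using fractional_star_operationsD(6)[OF s _ T] that by simp
    then show ?thesis
      using that by (auto simp: l_coset_image)
  qed
  \<comment> \<open>Invariance of \<open>s T\<close> under \<open>T\<close> passes to \<open>J\<close>, which with \<open>JT = T\<close> forces \<open>J = T\<close>.\<close>
  have J_eq: "J = inv x <# s T"
    using l_coset_cancel(1)[OF x F0_D(4)[OF J]] sT_eq by simp
  have J_smult: "j \<otimes> t \<in> J" if "j \<in> J" "t \<in> T" for j t
  proof -
    have "j \<in> inv x <# s T"
      using that(1) J_eq by simp
    then obtain y where y: "y \<in> s T" "j = inv x \<otimes> y"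
      unfolding l_coset_image by blast
    then have "y \<in> carrier K"
      using fractional_ideal_carrier[OF sT(1)] by blast
    then have "j \<otimes> t = inv x \<otimes> (t \<otimes> y)"
      using y that x by (simp add: m_ac)
    then show ?thesis
      using T_smult[OF that(2) y(1)] l_coset_image[of K "inv x" "s T"] J_eq by simp
  qed
  have "y \<in> J" if "y \<in> J \<cdot>\<^bsub>B\<^esub> T" for y
    using that by induction (use J_smult F0_D(1)[OF J] in \<open>auto simp: submodules_iff\<close>)
  then have "J = T"
    using F0_D(3,5)[OF J] by blast
  then have sT_x: "s T = x <# T"
    using sT_eq by simp
  have "x <# s T = s T"
    using fractional_star_operationsD(5,6)[OF s] T x sT_x by metis
  then have "inv x <# (x <# s T) = inv x <# s T"
    by simp
  then show ?thesis
    using l_coset_cancel(1)[OF x] fractional_ideal_carrier[OF sT(1)] sT_x T_closed(1) by simp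
qed

lemma star_restriction_multiplicative:
  assumes s: "s \<in> fractional_star_operations K D"
  shows "restrict s (F0 D B) \<in> multiplicative_operations B (F0 D B)"
proof (rule multiplicative_operationsI)
  have T: "T \<in> fractional_ideals K D"
    using F0_fractional[OF T_in_F0] .
  have s_in: "s J \<in> F0 D B" if J: "J \<in> F0 D B" for J
  proof -
    have "s J \<subseteq> T"
      using fractional_star_operationsD(4)[OF s F0_fractional[OF J] T F0_D(3)[OF J]]
        star_fixes_overring[OF s] by simp
    moreover have "s J \<in> fractional_ideals K D" "J \<subseteq> s J"
      using fractional_star_operationsD(2,3)[OF s F0_fractional[OF J]] .
    ultimately show ?thesis
      using B.F0_upward_closed[OF J, of "s J"] by (simp add: submodules_overring fractional_ideals_def)
  qed
  then show "restrict s (F0 D B) \<in> F0 D B \<rightarrow>\<^sub>E F0 D B"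
    by auto
  fix J assume J: "J \<in> F0 D B"
  show "J \<subseteq> restrict s (F0 D B) J"
    using J fractional_star_operationsD(3)[OF s F0_fractional] by simp
  show "restrict s (F0 D B) (restrict s (F0 D B) J) = restrict s (F0 D B) J"
    using J s_in fractional_star_operationsD(5)[OF s F0_fractional] by simp
  show "restrict s (F0 D B) J \<subseteq> restrict s (F0 D B) J'" if "J' \<in> F0 D B" "J \<subseteq> J'" for J'
    using J that fractional_star_operationsD(4)[OF s F0_fractional F0_fractional] by simp
  fix b assume b: "b \<in> carrier B" and res: "residual B J b \<in> F0 D B"
  have bK: "b \<in> carrier K"
    using b by simp
  have "b <# s (residual B J b) = s (b <# residual B J b)"
    using fractional_star_operationsD(6)[OF s bK F0_fractional[OF res]] .
  also have "\<dots> \<subseteq> s J"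
    using fractional_star_operationsD(4)[OF s scaled_F0_fractional[OF res bK] F0_fractional[OF J]]
    by (auto simp: l_coset_image residual_def)
  finally show "restrict s (F0 D B) (residual B J b) \<subseteq> residual B (restrict s (F0 D B) J) b"
    using J res F0_D(3)[OF s_in[OF res]] by (auto simp: residual_def l_coset_image)
qed

text \<open>Homogeneity reduces a nonzero ideal to its factor in \<open>F0\<close>; scaling by \<open>\<zero>\<close> shows that every star
  operation fixes the zero ideal.\<close>

lemma star_determined_by_F0:
  assumes s: "s \<in> fractional_star_operations K D" and t: "t \<in> fractional_star_operations K D"
    and le: "\<And>J. J \<in> F0 D B \<Longrightarrow> s J \<subseteq> t J" and F: "F \<in> fractional_ideals K D"
  shows "s F \<subseteq> t F"
  using F
proof (rule fractional_ideal_cases)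
  assume F0: "F = {\<zero>}"
  have "s {\<zero>} = \<zero> <# s {\<zero>}"
    using fractional_star_operationsD(6)[OF s _ zero_fractional, of \<zero>] by (simp add: l_coset_image)
  also have "\<dots> \<subseteq> {\<zero>}"
    using fractional_ideal_carrier[OF fractional_star_operationsD(2)[OF s zero_fractional]]
    by (auto simp: l_coset_image)
  also have "\<dots> \<subseteq> t {\<zero>}"
    using fractional_star_operationsD(3)[OF t zero_fractional] .
  finally show ?thesis
    by (simp add: F0)
next
  fix x J assume x: "x \<in> carrier K" "x \<noteq> \<zero>" and J: "J \<in> F0 D B" and F_eq: "F = x <# J"
  show ?thesis
    using l_coset_mono[OF le[OF J]] F_eq x F0_fractional[OF J]
      fractional_star_operationsD(6)[OF s] fractional_star_operationsD(6)[OF t] by metis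
qed

text \<open>Restriction to \<open>F0\<close> and extension by scaling are mutually inverse and monotone.\<close>

theorem FStar_Mult0_isomorphic: "order_isomorphic (FStar K D) (Mult0 D B)"
  unfolding FStar_def Mult0_def Mult_def
proof (rule order_isomorphic_pointwise_orderI
    [where f = "\<lambda>s. restrict s (F0 D B)" and g = star_extension])
  have ext_restrict: "restrict (star_extension t) (F0 D B) = t"
    if t: "t \<in> multiplicative_operations B (F0 D B)" for t
  proof (rule extensionalityI[of _ "F0 D B"])
    show "t \<in> extensional (F0 D B)"
      using t multiplicative_operations_extensional by blast
    fix J assume J: "J \<in> F0 D B"
    then show "restrict (star_extension t) (F0 D B) J = t J"
      using star_extension_scaled[OF t J, of \<one>] multiplicative_operationsD(2)[OF t J]
      by (simp add: l_coset_one F0_D(4))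
  qed auto
  then show "restrict (star_extension t) (F0 D B) = t"
    if "t \<in> multiplicative_operations B (F0 D B)" for t
    using that .
  show star_ext: "fractional_star_operations K D \<subseteq> extensional (fractional_ideals K D)"
    by (auto dest!: fractional_star_operationsD(1) simp: PiE_def)
  show "star_extension (restrict s (F0 D B)) = s" if s: "s \<in> fractional_star_operations K D" for s
  proof (rule extensionalityI[of _ "fractional_ideals K D"])
    let ?s' = "star_extension (restrict s (F0 D B))"
    have s': "?s' \<in> fractional_star_operations K D"
      by (intro star_extension_star_operation star_restriction_multiplicative s)
    then show "?s' \<in> extensional (fractional_ideals K D)"
      using star_ext by blast
    have "?s' J = s J" if "J \<in> F0 D B" for J
      using fun_cong[OF ext_restrict[OF star_restriction_multiplicative[OF s]], of J] that by simp
    then show "?s' F = s F" if "F \<in> fractional_ideals K D" for F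
      using star_determined_by_F0[OF s s' _ that] star_determined_by_F0[OF s' s _ that] by auto
  qed (use s star_ext in auto)
  fix s t F
  assume st: "s \<in> multiplicative_operations B (F0 D B)" "t \<in> multiplicative_operations B (F0 D B)"
    and le: "\<forall>J\<in>F0 D B. s J \<subseteq> t J" and F: "F \<in> fractional_ideals K D"
  from F show "star_extension s F \<subseteq> star_extension t F"
    by (rule fractional_ideal_cases) (use st le in \<open>simp_all add: star_extension_scaled l_coset_mono\<close>)
qed (use star_restriction_multiplicative star_extension_star_operation F0_fractional
      subsetD[OF multiplicative_operations_extensional] in auto)

section \<open>The quotient by the conductor\<close>

lemma conductor_ideal: "ideal (conductor K D T) B"
proof -
  let ?I = "conductor K D T"
  have sub: "?I \<subseteq> T"
  proof
    fix x assume "x \<in> ?I"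
    then have "x \<otimes> \<one> \<in> D" "x \<in> carrier K"
      using T_closed(3) unfolding conductor_def by blast+
    then show "x \<in> T"
      using D_sub_T by auto
  qed
  have "?I \<in> submodules D K"
    unfolding submodules_iff conductor_def
    by (auto simp: l_distr l_minus m_assoc)
  then have "?I \<in> submodules D B"
    using sub by (simp add: submodules_overring)
  then have subgroup: "subgroup ?I (add_monoid B)"
    by (simp add: submodules_def subalgebra_def)
  have smult: "x \<otimes> t \<in> ?I" if "x \<in> ?I" "t \<in> T" for x t
    using that unfolding conductor_def by (simp add: m_assoc)
  moreover have "t \<otimes> x = x \<otimes> t" if "x \<in> ?I" "t \<in> T" for x t
    using that unfolding conductor_def by (simp add: m_comm)
  ultimately show ?thesis
    by (intro idealI[OF B.ring_axioms subgroup]) simp_all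
qed

text \<open>Write \<open>\<one>\<close> as a sum of products \<open>j t\<close>. Then \<open>i\<close> is the sum of the \<open>(i t) j\<close>, whose coefficients
  \<open>i t\<close> lie in \<open>D\<close>.\<close>

lemma conductor_subset_F0:
  assumes J: "J \<in> F0 D B"
  shows "conductor K D T \<subseteq> J"
proof
  fix i assume i: "i \<in> conductor K D T"
  then have iK: "i \<in> carrier K"
    by (simp add: conductor_def)
  have "i \<otimes> y \<in> J \<and> y \<in> T" if "y \<in> J \<cdot>\<^bsub>B\<^esub> T" for y
    using that
  proof induction
    case (prod j t)
    have j: "j \<in> T"
      using prod F0_D(3)[OF J] by blast
    have "(i \<otimes> t) \<otimes> j \<in> J"
      using i prod F0_D(1)[OF J] by (auto simp: conductor_def submodules_iff)
    moreover have "i \<otimes> (j \<otimes> t) = (i \<otimes> t) \<otimes> j"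
      using iK j prod by (simp add: m_ac)
    ultimately show ?case
      using j prod by simp
  next
    case (sum y z)
    then show ?case
      using iK F0_D(1)[OF J] by (auto simp: r_distr submodules_iff)
  qed
  from this[of \<one>] show "i \<in> J"
    using F0_D(5)[OF J] iK by simp
qed

text \<open>The conductor is the kernel of the canonical projection. A coset of it by an element of \<open>D\<close> is the
  same set in \<open>D/I\<close> as in \<open>T/I\<close>, so \<open>D/I\<close> is literally the image of \<open>D\<close>.\<close>

theorem Mult0_conductor_quotient:
  "order_isomorphic (Mult0 D B)
     (Mult0 (carrier (K\<lparr>carrier := D\<rparr> Quot conductor K D T)) (B Quot conductor K D T))"
proof -
  let ?I = "conductor K D T"
  interpret I: ideal ?I B
    by (rule conductor_ideal)
  interpret quot: ring_hom_ring B "B Quot ?I" "(+>\<^bsub>B\<^esub>) ?I"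
    by (rule I.rcos_ring_hom_ring)
  have surj: "(+>\<^bsub>B\<^esub>) ?I ` carrier B = carrier (B Quot ?I)"
    by (auto simp: FactRing_def A_RCOSETS_def')
  have D_quot: "(+>\<^bsub>B\<^esub>) ?I ` D = carrier (K\<lparr>carrier := D\<rparr> Quot ?I)"
    by (auto simp: FactRing_def A_RCOSETS_def' a_r_coset_def')
  have kernel: "a_kernel B (B Quot ?I) ((+>\<^bsub>B\<^esub>) ?I) \<subseteq> ?I"
  proof
    fix x assume "x \<in> a_kernel B (B Quot ?I) ((+>\<^bsub>B\<^esub>) ?I)"
    then have "x \<in> carrier B" "?I +>\<^bsub>B\<^esub> x = ?I"
      unfolding a_kernel_def' by (simp_all add: FactRing_def)
    then show "x \<in> ?I"
      using I.a_rcos_self[of x] by simp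
  qed
  have "D \<subseteq> carrier B"
    using D_sub_T by simp
  then have "order_isomorphic (Mult0 D B) (Mult0 ((+>\<^bsub>B\<^esub>) ?I ` D) (B Quot ?I))"
    by (rule quot.Mult0_surjective_image[OF surj]) (rule subset_trans[OF kernel conductor_subset_F0])
  then show ?thesis
    unfolding D_quot .
qed

end

theorem theorem6p4:
  fixes K :: "('a, 'b) ring_scheme" and D T I :: "'a set"
  assumes "quotient_field K D"
    and "subring T K" and "D \<subseteq> T" and "principal_domain (K\<lparr>carrier := T\<rparr>)"
    and "I = conductor K D T" and "I \<noteq> {\<zero>\<^bsub>K\<^esub>}"
  defines "T_I \<equiv> K\<lparr>carrier := T\<rparr> Quot I"
    and "D_I \<equiv> carrier (K\<lparr>carrier := D\<rparr> Quot I)"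
  shows "order_isomorphic (FStar K D) (Mult0 D (K\<lparr>carrier := T\<rparr>)) \<and>
         order_isomorphic (Mult0 D (K\<lparr>carrier := T\<rparr>)) (Mult0 D_I T_I) \<and>
         order_isomorphic (FStar K D) (Mult0 D_I T_I)"
proof -
  interpret principal_overring K D T
    using assms(1-4,6) unfolding assms(5) by (rule principal_overring.intro)
  have "order_isomorphic (Mult0 D (K\<lparr>carrier := T\<rparr>)) (Mult0 D_I T_I)"
    using Mult0_conductor_quotient unfolding T_I_def D_I_def assms(5) .
  then show ?thesis
    using FStar_Mult0_isomorphic order_isomorphic_trans by blast
qed

end
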